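(* The hexablock $\mathbb H$ is a domain (i.e. a non-empty connected open set) in $\mathbb C^4$.
   Context: $\mathbb D$ is the open unit disc in $\mathbb C$, $\overline{\mathbb D}$ its closure. The tetrablock is $\mathbb E=\{(x_1,x_2,x_3)\in\mathbb C^3: 1-x_1z_1-x_2z_2+x_3z_1z_2\ne0 \text{ for all } z_1,z_2\in\overline{\mathbb D}\}$. The hexablock is $$\mathbb H=\left\{(a,x_1,x_2,x_3)\in\mathbb C\times\mathbb E:\ \sup_{z_1,z_2\in\mathbb D}\left|\frac{a\sqrt{(1-|z_1|^2)(1-|z_2|^2)}}{1-x_1z_1-x_2z_2+x_3z_1z_2}\right|<1\right\}.$$ *)

theory Defs
  imports "HOL-Analysis.Analysis"
begin

definition tetrablock :: "(complex \<times> complex \<times> complex) set" where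
  "tetrablock = {(x1, x2, x3).
     \<forall>z1 \<in> cball 0 1. \<forall>z2 \<in> cball 0 1. 1 - x1 * z1 - x2 * z2 + x3 * z1 * z2 \<noteq> 0}"

text \<open>The supremum is taken in the extended reals, so that it would be \<open>\<infinity>\<close>, hence not below \<open>1\<close>,
  if the family were unbounded; the supremum of an unbounded set of reals is unspecified in HOL.\<close>

definition hexablock :: "(complex \<times> complex \<times> complex \<times> complex) set" where
  "hexablock = {(a, x1, x2, x3). (x1, x2, x3) \<in> tetrablock \<and>
     (SUP (z1, z2) \<in> ball (0::complex) 1 \<times> ball (0::complex) 1.
        ereal (norm (a * complex_of_real (sqrt ((1 - (norm z1)\<^sup>2) * (1 - (norm z2)\<^sup>2)))
                     / (1 - x1 * z1 - x2 * z2 + x3 * z1 * z2)))) < 1}"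

end

theory Submission
  imports Defs
begin

text \<open>
  Write \<open>D\<^sub>x(z) = 1 - x\<^sub>1 z\<^sub>1 - x\<^sub>2 z\<^sub>2 + x\<^sub>3 z\<^sub>1 z\<^sub>2\<close> and
  \<open>w(z) = sqrt ((1 - |z\<^sub>1|\<^sup>2) (1 - |z\<^sub>2|\<^sup>2))\<close>. The key is to replace the supremum by a
  pointwise inequality: \<open>(a, x)\<close> lies in the hexablock iff \<open>|a| w(z) < |D\<^sub>x(z)|\<close> for all \<open>z\<close> in
  the closed bidisc (\<open>mem_hexablock_iff\<close>). On the boundary of the bidisc \<open>w\<close> vanishes, so there the
  inequality says just \<open>D\<^sub>x(z) \<noteq> 0\<close>, as for the tetrablock; and since the closed bidisc is
  compact, the pointwise strict inequality keeps the quotient bounded away from 1.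

  Openness then holds because a strict inequality between continuous functions that is required
  for all values of a parameter in a compact set is an open condition. For connectedness, the curve
  \<open>r \<mapsto> (r a, r x\<^sub>1, r x\<^sub>2, r\<^sup>2 x\<^sub>3)\<close>, \<open>0 \<le> r \<le> 1\<close>, joins the origin to \<open>(a, x)\<close> inside the
  hexablock: dilating \<open>x\<close> in this way amounts to evaluating \<open>D\<^sub>x\<close> at \<open>r z\<close> instead of \<open>z\<close>, while
  \<open>|r a| \<le> |a|\<close> and \<open>w(z) \<le> w(r z)\<close> (\<open>dilate_in_hexablock\<close>).
\<close>

definition tetra_denom :: "complex \<times> complex \<times> complex \<Rightarrow> complex \<times> complex \<Rightarrow> complex" where
  "tetra_denom = (\<lambda>(x1, x2, x3) (z1, z2). 1 - x1 * z1 - x2 * z2 + x3 * z1 * z2)"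

definition bidisc_weight :: "complex \<times> complex \<Rightarrow> real" where
  "bidisc_weight = (\<lambda>(z1, z2). sqrt ((1 - (norm z1)\<^sup>2) * (1 - (norm z2)\<^sup>2)))"

abbreviation closed_bidisc :: "(complex \<times> complex) set" where
  "closed_bidisc \<equiv> cball 0 1 \<times> cball 0 1"

lemma continuous_on_tetra_denom [continuous_intros]:
  assumes "continuous_on S f" "continuous_on S g"
  shows "continuous_on S (\<lambda>p. tetra_denom (f p) (g p))"
  unfolding tetra_denom_def case_prod_unfold by (intro continuous_intros assms)

lemma continuous_on_bidisc_weight [continuous_intros]:
  assumes "continuous_on S g"
  shows "continuous_on S (\<lambda>p. bidisc_weight (g p))"
  unfolding bidisc_weight_def case_prod_unfold by (intro continuous_intros assms)

lemma bidisc_weight_nonneg: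
  assumes "z \<in> closed_bidisc"
  shows "0 \<le> bidisc_weight z"
  using assms by (auto simp: bidisc_weight_def power_le_one)

lemma bidisc_weight_eq_0:
  assumes "z \<in> closed_bidisc" "z \<notin> ball 0 1 \<times> ball 0 1"
  shows "bidisc_weight z = 0"
proof -
  have "norm (fst z) = 1 \<or> norm (snd z) = 1"
    using assms by (cases z) auto
  then show ?thesis
    by (auto simp: bidisc_weight_def case_prod_unfold)
qed

lemma bidisc_weight_le_dilate:
  assumes "(z1, z2) \<in> closed_bidisc" "0 \<le> r" "r \<le> 1"
  shows "bidisc_weight (z1, z2) \<le> bidisc_weight (of_real r * z1, of_real r * z2)"
proof -
  have le: "1 - (norm z)\<^sup>2 \<le> 1 - (norm (of_real r * z))\<^sup>2" for z :: complex
    using assms(2,3) by (simp add: norm_mult power_mono mult_left_le_one_le)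
  have nn: "0 \<le> 1 - (norm z)\<^sup>2" if "norm z \<le> 1" for z :: complex
    using that by (simp add: power_le_one)
  have "0 \<le> 1 - (norm z1)\<^sup>2" "0 \<le> 1 - (norm z2)\<^sup>2"
    by (rule nn; use assms(1) in simp)+
  moreover have "0 \<le> 1 - (norm (of_real r * z1))\<^sup>2"
    using order_trans [OF calculation(1) le] .
  ultimately show ?thesis
    unfolding bidisc_weight_def prod.case by (intro real_sqrt_le_mono mult_mono le)
qed

text \<open>
  From right to left, the inequality makes the denominator nonzero, so the quotient is continuous on
  the compact closed bidisc; its maximum there is below 1 and bounds the supremum over the open
  bidisc. From left to right, the supremum only controls the open bidisc, and on the boundary the
  left-hand side is 0.
\<close>
lemma mem_hexablock_iff:
  "(a, x) \<in> hexablock \<longleftrightarrow>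
     (\<forall>z \<in> closed_bidisc. norm a * bidisc_weight z < norm (tetra_denom x z))"
proof -
  let ?q = "\<lambda>z. norm (a * complex_of_real (bidisc_weight z) / tetra_denom x z)"
  let ?B = "ball (0::complex) 1 \<times> ball (0::complex) 1"
  have mem: "(a, x) \<in> hexablock \<longleftrightarrow>
      (\<forall>z \<in> closed_bidisc. tetra_denom x z \<noteq> 0) \<and> (SUP z \<in> ?B. ereal (?q z)) < 1"
    by (cases x) (simp add: hexablock_def tetrablock_def tetra_denom_def bidisc_weight_def
        case_prod_unfold)
  have q_less: "?q z < 1 \<longleftrightarrow> norm a * bidisc_weight z < norm (tetra_denom x z)"
    if "z \<in> closed_bidisc" "tetra_denom x z \<noteq> 0" for z
    using that bidisc_weight_nonneg [OF that(1)]
    by (simp add: norm_mult norm_divide divide_less_eq)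
  show ?thesis
  proof
    assume L: "(a, x) \<in> hexablock"
    show "\<forall>z \<in> closed_bidisc. norm a * bidisc_weight z < norm (tetra_denom x z)"
    proof
      fix z assume z: "z \<in> closed_bidisc"
      show "norm a * bidisc_weight z < norm (tetra_denom x z)"
      proof (cases "z \<in> ?B")
        case True
        then have "ereal (?q z) \<le> (SUP z \<in> ?B. ereal (?q z))"
          by (rule SUP_upper)
        also have "\<dots> < 1"
          using L mem by blast
        finally have "?q z < 1"
          by simp
        then show ?thesis
          using q_less [OF z] L mem z by blast
      next
        case False
        moreover have "tetra_denom x z \<noteq> 0"
          using L mem z by blast
        ultimately show ?thesis
          using bidisc_weight_eq_0 [OF z] by simp
      qed
    qed
  next
    assume R: "\<forall>z \<in> closed_bidisc. norm a * bidisc_weight z < norm (tetra_denom x z)"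
    have nz: "tetra_denom x z \<noteq> 0" if "z \<in> closed_bidisc" for z
    proof -
      have "0 \<le> norm a * bidisc_weight z"
        using bidisc_weight_nonneg [OF that] by simp
      also have "\<dots> < norm (tetra_denom x z)"
        using R that by blast
      finally show ?thesis by simp
    qed
    have "continuous_on closed_bidisc ?q"
      by (intro continuous_intros ballI nz)
    moreover have "compact closed_bidisc" "closed_bidisc \<noteq> {}"
      by (simp_all add: compact_Times)
    ultimately obtain m where m: "m \<in> closed_bidisc" "\<forall>z \<in> closed_bidisc. ?q z \<le> ?q m"
      using continuous_attains_sup [of closed_bidisc ?q] by auto
    have "?q m < 1"
      using R m(1) nz q_less by blast
    have "(SUP z \<in> ?B. ereal (?q z)) \<le> ereal (?q m)"
    proof (rule SUP_least)
      fix z assume "z \<in> ?B"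
      then have "z \<in> closed_bidisc"
        by auto
      then show "ereal (?q z) \<le> ereal (?q m)"
        unfolding ereal_less_eq(3) using m(2) by blast
    qed
    also have "\<dots> < 1"
      using \<open>?q m < 1\<close> by simp
    finally show "(a, x) \<in> hexablock"
      using nz mem by blast
  qed
qed

text \<open>
  The complement is the projection of a closed set along the compact closed bidisc, and such
  projections are closed maps.
\<close>
lemma open_hexablock: "open hexablock"
proof -
  let ?C = "{p :: (complex \<times> complex) \<times> complex \<times> complex \<times> complex \<times> complex.
    norm (tetra_denom (snd (snd p)) (fst p)) \<le> norm (fst (snd p)) * bidisc_weight (fst p)}"
  have "closed ?C"
    by (intro closed_Collect_le continuous_intros)
  moreover have "compact closed_bidisc"
    by (intro compact_Times compact_cball)
  ultimately have cl: "closed {p. \<exists>z. z \<in> closed_bidisc \<and> (z, p) \<in> ?C}"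
    by (intro closed_compact_projection)
  have "p \<in> hexablock \<longleftrightarrow> (\<forall>z \<in> closed_bidisc. (z, p) \<notin> ?C)" for p
    by (cases p) (simp add: mem_hexablock_iff not_le)
  then have eq: "hexablock = - {p. \<exists>z. z \<in> closed_bidisc \<and> (z, p) \<in> ?C}"
    by blast
  show ?thesis
    unfolding eq using cl by (rule open_Compl)
qed

lemma zero_in_hexablock: "0 \<in> hexablock"
  by (simp add: zero_prod_def mem_hexablock_iff tetra_denom_def)

text \<open>
  The coefficient \<open>x\<^sub>3\<close> has to be scaled by \<open>r\<^sup>2\<close> because it multiplies \<open>z\<^sub>1 z\<^sub>2\<close>: then
  the denominator of the dilated coefficients at \<open>z\<close> is that of \<open>x\<close> at \<open>r z\<close>. The weight only
  grows when \<open>z\<close> moves to \<open>r z\<close>, so the inequality for \<open>(a, x)\<close> at \<open>r z\<close> is stronger than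
  the required one.
\<close>
lemma dilate_in_hexablock:
  assumes "(a, x1, x2, x3) \<in> hexablock" "0 \<le> r" "r \<le> 1"
  shows "(of_real r * a, of_real r * x1, of_real r * x2, of_real (r\<^sup>2) * x3) \<in> hexablock"
  unfolding mem_hexablock_iff
proof
  fix z assume z: "z \<in> closed_bidisc"
  obtain z1 z2 where [simp]: "z = (z1, z2)"
    by (cases z)
  let ?rz = "(of_real r * z1, of_real r * z2)"
  have rz: "?rz \<in> closed_bidisc"
    using z assms(2,3) by (auto simp: norm_mult intro: mult_le_one)
  have "norm (of_real r * a) * bidisc_weight z \<le> norm a * bidisc_weight ?rz"
    using assms(2,3) z bidisc_weight_nonneg [OF z] bidisc_weight_le_dilate [of z1 z2 r]
    by (intro mult_mono) (auto simp: norm_mult mult_left_le_one_le)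
  also have "\<dots> < norm (tetra_denom (x1, x2, x3) ?rz)"
    using assms(1) rz mem_hexablock_iff by blast
  also have "tetra_denom (x1, x2, x3) ?rz =
      tetra_denom (of_real r * x1, of_real r * x2, of_real (r\<^sup>2) * x3) z"
    by (simp add: tetra_denom_def power2_eq_square algebra_simps)
  finally show "norm (of_real r * a) * bidisc_weight z
      < norm (tetra_denom (of_real r * x1, of_real r * x2, of_real (r\<^sup>2) * x3) z)" .
qed

lemma connected_hexablock: "connected hexablock"
proof -
  have "\<exists>T. connected T \<and> T \<subseteq> hexablock \<and> 0 \<in> T \<and> p \<in> T" if p: "p \<in> hexablock" for p
  proof -
    obtain a x1 x2 x3 where p_eq: "p = (a, x1, x2, x3)"
      by (cases p)
    define \<gamma> where
      "\<gamma> r = (of_real r * a, of_real r * x1, of_real r * x2, of_real (r\<^sup>2) * x3)" for r :: real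
    have "connected (\<gamma> ` {0..1})"
      unfolding \<gamma>_def by (intro connected_continuous_image continuous_intros) simp
    moreover have "\<gamma> ` {0..1} \<subseteq> hexablock"
      using p dilate_in_hexablock by (auto simp: \<gamma>_def p_eq)
    moreover have "\<gamma> 0 = 0" "\<gamma> 1 = p"
      by (simp_all add: \<gamma>_def p_eq zero_prod_def)
    then have "0 \<in> \<gamma> ` {0..1}" "p \<in> \<gamma> ` {0..1}"
      by force+
    ultimately show ?thesis
      by blast
  qed
  then have "connected_component hexablock 0 p" if "p \<in> hexablock" for p
    using that by (simp add: connected_component_def)
  then show ?thesis
    unfolding connected_iff_connected_component
    by (blast intro: connected_component_sym connected_component_trans)
qed

theorem proposition5p2:
  shows "hexablock \<noteq> {} \<and> open hexablock \<and> connected hexablock"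
  using zero_in_hexablock open_hexablock connected_hexablock by blast

end
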